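(* There exist absolute constants $\lambda_0\ge1$ and $C>0$ such that the following holds for every $N\ge1$ and every $\lambda\ge\lambda_0$. Let $T$ be the dyadic tree of depth $N$, and let $\mu$ be a non-negative measure on $\partial T^2$ such that $\mathbb V^\mu\le1$ on $\operatorname{supp}(\mu)$ and $\mathbb V^\mu\ge\lambda$ on a set $F\subset\partial T^2$. Then there exists a non-negative function $\varphi$ on $T^2$ such that $$\mathbb I\varphi(\omega)\ge\lambda\quad\text{for all }\omega\in F,\qquad\text{and}\qquad \|\varphi\|^2_{\ell^2(T^2)}\le\frac{C}{\lambda}\,\mathcal E[\mu].$$
   Context: $T$ is the finite dyadic tree of depth $N$: its nodes are the dyadic subintervals of $[0,1]$ of length $2^{-k}$, $0\le k\le N$; its boundary $\partial T$ is the set of dyadic intervals of length $2^{-N}$. The bi-tree is $T^2=T\times T$; a node $\alpha\in T^2$ is identified with the dyadic rectangle $R_\alpha\subset[0,1]^2$, and $\alpha\le\beta$ means $R_\alpha\subset R_\beta$. The boundary $\partial T^2=(\partial T)^2$ consists of the dyadic squares $\omega$ of side $2^{-N}$. A measure $\mu$ on $\partial T^2$ assigns a finite mass $\mu(\omega)\ge0$ to each $\omega\in\partial T^2$; $\operatorname{supp}(\mu)=\{\omega\in\partial T^2:\mu(\omega)>0\}$. For a dyadic rectangle, $\mu(R_\alpha)=\sum_{\omega\in\partial T^2,\ \omega\le\alpha}\mu(\omega)$. The potential is $\mathbb V^\mu(\alpha)=\sum_{\beta\in T^2,\ \beta\ge\alpha}\mu(R_\beta)$, $\alpha\in T^2$,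 and the energy is $\mathcal E[\mu]=\sum_{\alpha\in T^2}\mu(R_\alpha)^2$. The Hardy operator is $\mathbb I\varphi(\alpha)=\sum_{\beta\ge\alpha}\varphi(\beta)$, and $\|\varphi\|^2_{\ell^2(T^2)}=\sum_{\alpha\in T^2}\varphi(\alpha)^2$. *)

theory Defs
  imports "HOL-Analysis.Analysis"
begin

text \<open>
  Dyadic intervals are taken closed, as subsets of \<open>[0,1]\<close>.  Only inclusions between
  them are used below, so half-open intervals would give the same ordered set.
\<close>

definition dyadic_interval :: "nat \<Rightarrow> nat \<Rightarrow> real set" where
  "dyadic_interval k j = {real j / 2 ^ k .. (real j + 1) / 2 ^ k}"

definition dyadic_tree :: "nat \<Rightarrow> real set set" where
  "dyadic_tree N = {dyadic_interval k j | k j. k \<le> N \<and> j < 2 ^ k}"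

definition dyadic_tree_boundary :: "nat \<Rightarrow> real set set" where
  "dyadic_tree_boundary N = {dyadic_interval N j | j. j < 2 ^ N}"

type_synonym node = "real set \<times> real set"

definition bitree :: "nat \<Rightarrow> node set" where
  "bitree N = dyadic_tree N \<times> dyadic_tree N"

definition bitree_boundary :: "nat \<Rightarrow> node set" where
  "bitree_boundary N = dyadic_tree_boundary N \<times> dyadic_tree_boundary N"

definition rect :: "node \<Rightarrow> (real \<times> real) set" where
  "rect \<alpha> = fst \<alpha> \<times> snd \<alpha>"

definition node_le :: "node \<Rightarrow> node \<Rightarrow> bool" where
  "node_le \<alpha> \<beta> \<longleftrightarrow> rect \<alpha> \<subseteq> rect \<beta>"

text \<open>
  A measure on the boundary of the bi-tree is given by its point masses; the values of
  \<open>\<mu>\<close> outside \<open>bitree_boundary N\<close> never enter.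
\<close>

definition boundary_measure :: "nat \<Rightarrow> (node \<Rightarrow> real) \<Rightarrow> bool" where
  "boundary_measure N \<mu> \<longleftrightarrow> (\<forall>\<omega>\<in>bitree_boundary N. 0 \<le> \<mu> \<omega>)"

definition measure_supp :: "nat \<Rightarrow> (node \<Rightarrow> real) \<Rightarrow> node set" where
  "measure_supp N \<mu> = {\<omega> \<in> bitree_boundary N. 0 < \<mu> \<omega>}"

definition mass :: "nat \<Rightarrow> (node \<Rightarrow> real) \<Rightarrow> node \<Rightarrow> real" where
  "mass N \<mu> \<alpha> = (\<Sum>\<omega> | \<omega> \<in> bitree_boundary N \<and> node_le \<omega> \<alpha>. \<mu> \<omega>)"

definition hardy :: "nat \<Rightarrow> (node \<Rightarrow> real) \<Rightarrow> node \<Rightarrow> real" where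
  "hardy N \<phi> \<alpha> = (\<Sum>\<beta> | \<beta> \<in> bitree N \<and> node_le \<alpha> \<beta>. \<phi> \<beta>)"

definition potential :: "nat \<Rightarrow> (node \<Rightarrow> real) \<Rightarrow> node \<Rightarrow> real" where
  "potential N \<mu> \<alpha> = (\<Sum>\<beta> | \<beta> \<in> bitree N \<and> node_le \<alpha> \<beta>. mass N \<mu> \<beta>)"

definition energy :: "nat \<Rightarrow> (node \<Rightarrow> real) \<Rightarrow> real" where
  "energy N \<mu> = (\<Sum>\<alpha>\<in>bitree N. (mass N \<mu> \<alpha>)\<^sup>2)"

definition l2_norm_sq :: "nat \<Rightarrow> (node \<Rightarrow> real) \<Rightarrow> real" where
  "l2_norm_sq N \<phi> = (\<Sum>\<alpha>\<in>bitree N. (\<phi> \<alpha>)\<^sup>2)"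

lemma finite_dyadic_tree: "finite (dyadic_tree N)"
proof -
  have "dyadic_tree N = (\<Union>k\<in>{..N}. dyadic_interval k ` {..<2 ^ k})"
    by (auto simp: dyadic_tree_def)
  then show ?thesis by simp
qed

lemma finite_bitree: "finite (bitree N)"
  by (simp add: bitree_def finite_dyadic_tree)

lemma bitree_boundary_subset: "bitree_boundary N \<subseteq> bitree N"
  by (auto simp: bitree_boundary_def bitree_def dyadic_tree_boundary_def dyadic_tree_def)

lemma finite_bitree_boundary: "finite (bitree_boundary N)"
  using bitree_boundary_subset finite_bitree by (rule finite_subset)

end

theory Submission
  imports Defs
begin

text \<open>
  Write \<open>f \<alpha> = \<mu>(R\<^sub>\<alpha>)\<close>, so that the potential of \<open>\<mu>\<close> is \<open>\<I> f\<close> for the Hardy operator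
  \<open>\<I> = I\<^sub>1 I\<^sub>2\<close>, where \<open>I\<^sub>1\<close> and \<open>I\<^sub>2\<close> sum over the ancestors in one coordinate only.  The
  function that works is \<open>\<phi> = (4 / \<lambda>) (I\<^sub>1 f) (I\<^sub>2 f)\<close>.

  \<^emph>\<open>Lower bound\<close> (\<open>square_hardy12_le\<close>).  The ancestors of a boundary point \<open>\<omega>\<close> form a product
  of two chains, and \<open>(\<I> f \<omega>)\<^sup>2\<close> is the sum of \<open>f \<beta> f \<beta>'\<close> over pairs of ancestors.  If one
  of the two rectangles contains the other, say \<open>\<beta> \<le> \<beta>'\<close>, summing over \<open>\<beta>'\<close> gives at most
  \<open>f \<beta> \<I> f \<beta>\<close>; this is at most \<open>f \<beta>\<close>, since a rectangle of positive mass contains a point of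
  the support, where \<open>\<I> f \<le> 1\<close>.  In the remaining pairs \<open>\<beta>\<close> is wider in one coordinate and
  \<open>\<beta>'\<close> in the other, and they are counted by the value of \<open>\<I> (I\<^sub>1 f \<cdot> I\<^sub>2 f)\<close> at \<open>\<omega>\<close>.  Hence
  \<open>(\<I> f)\<^sup>2 \<le> 2 \<I> f + 2 \<I> (I\<^sub>1 f \<cdot> I\<^sub>2 f)\<close>, and the first term is absorbed as soon as \<open>\<I> f \<ge> 4\<close>.

  \<^emph>\<open>Norm bound\<close> (\<open>sum_square_hardy1_hardy2_le\<close>).  On a chain \<open>(I\<^sub>1 f)\<^sup>2 \<le> 2 I\<^sub>1 (f \<cdot> I\<^sub>1 f)\<close>, and
  likewise for \<open>I\<^sub>2\<close>.  After these two inequalities the sum of \<open>(I\<^sub>1 f)\<^sup>2 (I\<^sub>2 f)\<^sup>2\<close> is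
  reorganised as a sum over \<open>(a, b)\<close> of a product of two factors, one running over the
  descendants of \<open>b\<close> and one over those of \<open>a\<close>.  Each factor is a one-parameter sum controlled
  by the Carleson-type inequality \<open>sum_mass_times_le\<close>, hence at most \<open>f (a, b)\<close>.  This gives
  \<open>4 \<E>[\<mu>]\<close>, so \<open>\<phi>\<close> has squared norm at most \<open>64 \<E>[\<mu>] / \<lambda>\<^sup>2\<close>, which for \<open>\<lambda> \<ge> 4\<close> is at
  most \<open>64 \<E>[\<mu>] / \<lambda>\<close>.
\<close>

section \<open>Hardy operators on a finite tree and on its square\<close>

text \<open>
  The only feature of a tree that matters is that the ancestors of a node form a chain.
\<close>

locale finite_tree =
  fixes T :: "'a::order set"
  assumes finite_T: "finite T"
    and ancestors_comparable:
      "\<lbrakk>x \<in> T; a \<in> T; b \<in> T; x \<le> a; x \<le> b\<rbrakk> \<Longrightarrow> a \<le> b \<or> b \<le> a"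
begin

definition anc :: "'a \<Rightarrow> 'a set" where
  "anc x = {a \<in> T. x \<le> a}"

definition hardy1 :: "('a \<Rightarrow> 'a \<Rightarrow> real) \<Rightarrow> 'a \<Rightarrow> 'a \<Rightarrow> real" where
  "hardy1 f x y = (\<Sum>a\<in>anc x. f a y)"

definition hardy2 :: "('a \<Rightarrow> 'a \<Rightarrow> real) \<Rightarrow> 'a \<Rightarrow> 'a \<Rightarrow> real" where
  "hardy2 f x y = (\<Sum>b\<in>anc y. f x b)"

definition hardy12 :: "('a \<Rightarrow> 'a \<Rightarrow> real) \<Rightarrow> 'a \<Rightarrow> 'a \<Rightarrow> real" where
  "hardy12 f x y = (\<Sum>a\<in>anc x. \<Sum>b\<in>anc y. f a b)"

lemma finite_anc [simp]: "finite (anc x)"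
  by (simp add: anc_def finite_T)

lemma anc_antimono: "x \<le> y \<Longrightarrow> anc y \<subseteq> anc x"
  by (auto simp: anc_def)

lemma anc_inter_above: "a \<in> anc x \<Longrightarrow> {b \<in> anc x. a \<le> b} = anc a"
  by (auto simp: anc_def)

lemma anc_comparable: "x \<in> T \<Longrightarrow> a \<in> anc x \<Longrightarrow> b \<in> anc x \<Longrightarrow> a \<le> b \<or> b \<le> a"
  using ancestors_comparable by (auto simp: anc_def)

lemma sum_anc_eq_of_bool:
  fixes g :: "'a \<Rightarrow> real"
  assumes "a \<in> anc x"
  shows "(\<Sum>b\<in>anc a. g b) = (\<Sum>b\<in>anc x. of_bool (a \<le> b) * g b)"
proof -
  have "(\<Sum>b\<in>anc a. g b) = (\<Sum>b\<in>anc x. if a \<le> b then g b else 0)"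
    unfolding anc_inter_above[OF assms, symmetric] by (rule sum.inter_filter) simp
  also have "\<dots> = (\<Sum>b\<in>anc x. of_bool (a \<le> b) * g b)"
    by (rule sum.cong) auto
  finally show ?thesis .
qed

lemma hardy12_eq_sum_hardy1: "hardy12 f x y = (\<Sum>b\<in>anc y. hardy1 f x b)"
  unfolding hardy12_def hardy1_def by (rule sum.swap)

lemma hardy1_transpose: "hardy1 (\<lambda>x y. f y x) x y = hardy2 f y x"
  by (simp add: hardy1_def hardy2_def)

lemma hardy12_transpose: "hardy12 (\<lambda>x y. f y x) x y = hardy12 f y x"
  unfolding hardy12_def by (rule sum.swap)

lemma hardy1_nonneg:
  assumes "\<And>a b. 0 \<le> f a b" shows "0 \<le> hardy1 f x y"
  unfolding hardy1_def by (intro sum_nonneg assms)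

lemma hardy2_nonneg:
  assumes "\<And>a b. 0 \<le> f a b" shows "0 \<le> hardy2 f x y"
  unfolding hardy2_def by (intro sum_nonneg assms)

lemma hardy12_antimono:
  assumes "\<And>a b. 0 \<le> f a b" and "x \<le> x'" and "y \<le> y'"
  shows "hardy12 f x' y' \<le> hardy12 f x y"
proof -
  have "hardy12 f x' y' \<le> (\<Sum>a\<in>anc x'. \<Sum>b\<in>anc y. f a b)"
    unfolding hardy12_def
    by (intro sum_mono sum_mono2 finite_anc anc_antimono assms)
  also have "\<dots> \<le> hardy12 f x y"
    unfolding hardy12_def
    by (intro sum_mono2 finite_anc anc_antimono assms sum_nonneg)
  finally show ?thesis .
qed

section \<open>Squares of sums over chains\<close>

text \<open>
  Of two ancestors of \<open>x\<close> one lies above the other, so the ordered pairs \<open>a \<le> b\<close> already carry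
  at least half of the square.
\<close>

lemma square_sum_anc_le:
  fixes g :: "'a \<Rightarrow> real"
  assumes x: "x \<in> T" and g: "\<And>a. 0 \<le> g a"
  shows "(\<Sum>a\<in>anc x. g a)\<^sup>2 \<le> 2 * (\<Sum>a\<in>anc x. g a * (\<Sum>b\<in>anc a. g b))"
proof -
  let ?A = "anc x"
  let ?S = "\<Sum>a\<in>?A. \<Sum>b\<in>?A. of_bool (a \<le> b) * (g a * g b)"
  have "(\<Sum>a\<in>?A. g a)\<^sup>2 = (\<Sum>a\<in>?A. \<Sum>b\<in>?A. g a * g b)"
    by (simp add: power2_eq_square sum_product)
  also have "\<dots> \<le> (\<Sum>a\<in>?A. \<Sum>b\<in>?A. of_bool (a \<le> b) * (g a * g b) + of_bool (b \<le> a) * (g a * g b))"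
  proof (intro sum_mono)
    fix a b assume "a \<in> ?A" "b \<in> ?A"
    then show "g a * g b \<le> of_bool (a \<le> b) * (g a * g b) + of_bool (b \<le> a) * (g a * g b)"
      using anc_comparable[OF x, of a b] g[of a] g[of b] by auto
  qed
  also have "\<dots> = ?S + (\<Sum>a\<in>?A. \<Sum>b\<in>?A. of_bool (b \<le> a) * (g a * g b))"
    by (simp add: sum.distrib)
  also have "(\<Sum>a\<in>?A. \<Sum>b\<in>?A. of_bool (b \<le> a) * (g a * g b)) = ?S"
    by (subst sum.swap) (simp add: mult.commute)
  also have "?S = (\<Sum>a\<in>?A. g a * (\<Sum>b\<in>anc a. g b))"
    by (intro sum.cong refl) (simp only: sum_anc_eq_of_bool sum_distrib_left mult_ac)
  finally show ?thesis by simp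
qed

text \<open>
  The square is a sum over pairs \<open>(a, b)\<close>, \<open>(a', b')\<close> of ancestors.  Both coordinates are
  comparable, which leaves four relative positions: two where one pair dominates the other,
  exchanged by symmetry, and two crossed ones, also exchanged by symmetry.
\<close>

lemma square_hardy12_le:
  assumes x: "x \<in> T" and y: "y \<in> T" and f: "\<And>a b. 0 \<le> f a b"
  shows "(hardy12 f x y)\<^sup>2 \<le> 2 * hardy12 (\<lambda>a b. f a b * hardy12 f a b) x y
    + 2 * hardy12 (\<lambda>a b. hardy1 f a b * hardy2 f a b) x y"
proof -
  let ?A = "anc x" and ?B = "anc y"
  let ?P = "?A \<times> ?B"
  let ?up = "\<lambda>p q :: 'a \<times> 'a. of_bool (fst p \<le> fst q \<and> snd p \<le> snd q) :: real"
  let ?cr = "\<lambda>p q :: 'a \<times> 'a. of_bool (fst p \<le> fst q \<and> snd q \<le> snd p) :: real"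
  define g where "g = (\<lambda>p q. f (fst p) (snd p) * f (fst q) (snd q))"
  let ?U = "\<Sum>p\<in>?P. \<Sum>q\<in>?P. ?up p q * g p q"
  let ?C = "\<Sum>p\<in>?P. \<Sum>q\<in>?P. ?cr p q * g p q"
  have g: "0 \<le> g p q" "g p q = g q p" for p q
    by (simp_all add: g_def f mult.commute)
  have "hardy12 f x y = (\<Sum>p\<in>?P. f (fst p) (snd p))"
    by (simp add: hardy12_def sum.cartesian_product case_prod_beta)
  then have "(hardy12 f x y)\<^sup>2 = (\<Sum>p\<in>?P. \<Sum>q\<in>?P. g p q)"
    by (simp add: power2_eq_square sum_product g_def)
  also have "\<dots> \<le> (\<Sum>p\<in>?P. \<Sum>q\<in>?P.
      (?up p q * g p q + ?up q p * g p q) + (?cr p q * g p q + ?cr q p * g p q))"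
  proof (intro sum_mono)
    fix p q assume "p \<in> ?P" "q \<in> ?P"
    then have "fst p \<le> fst q \<or> fst q \<le> fst p" "snd p \<le> snd q \<or> snd q \<le> snd p"
      using anc_comparable[OF x, of "fst p" "fst q"] anc_comparable[OF y, of "snd p" "snd q"]
      by auto
    then show "g p q \<le>
      (?up p q * g p q + ?up q p * g p q) + (?cr p q * g p q + ?cr q p * g p q)"
      using g(1)[of p q] by auto
  qed
  also have "\<dots> = (?U + (\<Sum>p\<in>?P. \<Sum>q\<in>?P. ?up q p * g p q))
      + (?C + (\<Sum>p\<in>?P. \<Sum>q\<in>?P. ?cr q p * g p q))"
    by (simp only: sum.distrib)
  also have "(\<Sum>p\<in>?P. \<Sum>q\<in>?P. ?up q p * g p q) = ?U"
    by (subst sum.swap) (simp only: g(2))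
  also have "(\<Sum>p\<in>?P. \<Sum>q\<in>?P. ?cr q p * g p q) = ?C"
    by (subst sum.swap) (simp only: g(2))
  also have "?U = hardy12 (\<lambda>a b. f a b * hardy12 f a b) x y"
  proof -
    have "?U = (\<Sum>a\<in>?A. \<Sum>b\<in>?B. \<Sum>a'\<in>?A. \<Sum>b'\<in>?B.
        of_bool (a \<le> a') * (of_bool (b \<le> b') * (f a b * f a' b')))"
      by (simp add: sum.cartesian_product' g_def of_bool_conj mult.assoc)
    also have "\<dots> = hardy12 (\<lambda>a b. f a b * hardy12 f a b) x y"
      unfolding hardy12_def
      by (intro sum.cong refl)
        (simp only: sum_anc_eq_of_bool[of _ x] sum_anc_eq_of_bool[of _ y] sum_distrib_left mult_ac)
    finally show ?thesis .
  qed
  also have "?C = hardy12 (\<lambda>a b. hardy1 f a b * hardy2 f a b) x y"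
  proof -
    have "?C = (\<Sum>a\<in>?A. \<Sum>b\<in>?B. \<Sum>a'\<in>?A. \<Sum>b'\<in>?B.
        of_bool (a \<le> a') * (of_bool (b' \<le> b) * (f a b * f a' b')))"
      by (simp add: sum.cartesian_product' g_def of_bool_conj mult.assoc)
    (* the corner of a crossed pair is (a, b'): a is the smaller first side, b' the smaller second *)
    also have "\<dots> = (\<Sum>a\<in>?A. \<Sum>a'\<in>?A. \<Sum>b\<in>?B. \<Sum>b'\<in>?B.
        of_bool (a \<le> a') * (of_bool (b' \<le> b) * (f a b * f a' b')))"
      by (rule sum.cong[OF refl], rule sum.swap)
    also have "\<dots> = (\<Sum>a\<in>?A. \<Sum>a'\<in>?A. \<Sum>b'\<in>?B. \<Sum>b\<in>?B.
        of_bool (a \<le> a') * (of_bool (b' \<le> b) * (f a b * f a' b')))"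
      by (rule sum.cong[OF refl], rule sum.cong[OF refl], rule sum.swap)
    also have "\<dots> = (\<Sum>a\<in>?A. \<Sum>b'\<in>?B. \<Sum>a'\<in>?A. \<Sum>b\<in>?B.
        of_bool (a \<le> a') * (of_bool (b' \<le> b) * (f a b * f a' b')))"
      by (rule sum.cong[OF refl], rule sum.swap)
    also have "\<dots> = hardy12 (\<lambda>a b. hardy1 f a b * hardy2 f a b) x y"
      unfolding hardy12_def hardy1_def hardy2_def
      by (intro sum.cong refl)
        (simp only: sum_anc_eq_of_bool[of _ x] sum_anc_eq_of_bool[of _ y] sum_product mult_ac)
    finally show ?thesis .
  qed
  finally show ?thesis by simp
qed

section \<open>The norm bound\<close>

text \<open>
  A one-parameter Carleson-type inequality: spreading the masses over the points \<open>v\<close> and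
  exchanging the sums, each \<open>v\<close> sees \<open>g\<close> only along its own ancestors, where \<open>g\<close> sums to at
  most \<open>d\<close> as soon as \<open>v\<close> carries mass.
\<close>

lemma sum_mass_times_le:
  fixes g \<nu> :: "'a \<Rightarrow> real"
  assumes B: "finite B" and g: "\<And>y. 0 \<le> g y" and \<nu>: "\<And>v. v \<in> B \<Longrightarrow> 0 \<le> \<nu> v"
    and le: "\<And>v. \<lbrakk>v \<in> B; 0 < \<nu> v\<rbrakk> \<Longrightarrow> (\<Sum>y\<in>anc v. g y) \<le> d"
  shows "(\<Sum>y | y \<in> T \<and> y \<le> b. (\<Sum>v | v \<in> B \<and> v \<le> y. \<nu> v) * g y)
    \<le> d * (\<Sum>v | v \<in> B \<and> v \<le> b. \<nu> v)"
proof -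
  let ?D = "{y \<in> T. y \<le> b}"
  have D: "finite ?D" using finite_T by simp
  have "(\<Sum>y\<in>?D. (\<Sum>v | v \<in> B \<and> v \<le> y. \<nu> v) * g y)
      = (\<Sum>y\<in>?D. \<Sum>v | v \<in> B \<and> v \<le> y. \<nu> v * g y)"
    by (simp add: sum_distrib_right)
  also have "\<dots> = (\<Sum>v\<in>B. \<Sum>y | y \<in> ?D \<and> v \<le> y. \<nu> v * g y)"
    by (rule sum.swap_restrict[OF D B])
  also have "\<dots> = (\<Sum>v | v \<in> B \<and> v \<le> b. \<Sum>y | y \<in> ?D \<and> v \<le> y. \<nu> v * g y)"
  proof (rule sum.mono_neutral_right)
    show "\<forall>v\<in>B - {v \<in> B. v \<le> b}. (\<Sum>y | y \<in> ?D \<and> v \<le> y. \<nu> v * g y) = 0"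
    proof
      fix v assume "v \<in> B - {v \<in> B. v \<le> b}"
      then have "{y. y \<in> ?D \<and> v \<le> y} = {}" by (auto dest: order_trans)
      then show "(\<Sum>y | y \<in> ?D \<and> v \<le> y. \<nu> v * g y) = 0" by (simp only: sum.empty)
    qed
  qed (use B in auto)
  also have "\<dots> \<le> (\<Sum>v | v \<in> B \<and> v \<le> b. d * \<nu> v)"
  proof (rule sum_mono)
    fix v assume "v \<in> {v \<in> B. v \<le> b}"
    then have v: "v \<in> B" by simp
    have "(\<Sum>y | y \<in> ?D \<and> v \<le> y. \<nu> v * g y) = \<nu> v * (\<Sum>y | y \<in> ?D \<and> v \<le> y. g y)"
      by (simp only: sum_distrib_left)
    also have "\<dots> \<le> \<nu> v * (\<Sum>y\<in>anc v. g y)"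
      by (intro mult_left_mono sum_mono2 \<nu> v g finite_anc) (auto simp: anc_def)
    also have "\<dots> \<le> d * \<nu> v"
    proof (cases "\<nu> v = 0")
      case False
      with \<nu>[OF v] have "0 < \<nu> v" by simp
      then show ?thesis using le[OF v] by (simp add: mult.commute)
    qed simp
    finally show "(\<Sum>y | y \<in> ?D \<and> v \<le> y. \<nu> v * g y) \<le> d * \<nu> v" .
  qed
  also have "\<dots> = d * (\<Sum>v | v \<in> B \<and> v \<le> b. \<nu> v)"
    by (simp only: sum_distrib_left)
  finally show ?thesis .
qed

definition mass2 :: "'a set \<Rightarrow> ('a \<Rightarrow> 'a \<Rightarrow> real) \<Rightarrow> 'a \<Rightarrow> 'a \<Rightarrow> real" where
  "mass2 B \<mu> a b = (\<Sum>u | u \<in> B \<and> u \<le> a. \<Sum>v | v \<in> B \<and> v \<le> b. \<mu> u v)"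

lemma mass2_transpose: "mass2 B (\<lambda>u v. \<mu> v u) a b = mass2 B \<mu> b a"
  unfolding mass2_def by (rule sum.swap)

lemma mass2_nonneg:
  assumes "\<And>u v. \<lbrakk>u \<in> B; v \<in> B\<rbrakk> \<Longrightarrow> 0 \<le> \<mu> u v"
  shows "0 \<le> mass2 B \<mu> a b"
  unfolding mass2_def by (intro sum_nonneg assms) auto

text \<open>
  A sum that is positive has a positive term, so a rectangle of positive mass lies above a
  point of the support, and potentials decrease upwards.
\<close>

lemma hardy12_mass2_le:
  assumes \<mu>: "\<And>u v. \<lbrakk>u \<in> B; v \<in> B\<rbrakk> \<Longrightarrow> 0 \<le> \<mu> u v"
    and V: "\<And>u v. \<lbrakk>u \<in> B; v \<in> B; 0 < \<mu> u v\<rbrakk> \<Longrightarrow> hardy12 (mass2 B \<mu>) u v \<le> d"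
    and pos: "0 < mass2 B \<mu> a b"
  shows "hardy12 (mass2 B \<mu>) a b \<le> d"
proof -
  have "\<exists>u v. u \<in> B \<and> u \<le> a \<and> v \<in> B \<and> v \<le> b \<and> 0 < \<mu> u v"
  proof (rule ccontr)
    assume "\<not> ?thesis"
    then have "mass2 B \<mu> a b \<le> 0"
      unfolding mass2_def by (intro sum_nonpos) (auto simp: not_less)
    with pos show False by simp
  qed
  then obtain u v where uv: "u \<in> B" "u \<le> a" "v \<in> B" "v \<le> b" "0 < \<mu> u v" by blast
  have "hardy12 (mass2 B \<mu>) a b \<le> hardy12 (mass2 B \<mu>) u v"
    by (rule hardy12_antimono) (use uv mass2_nonneg[of B \<mu>] \<mu> in auto)
  also have "\<dots> \<le> d" by (rule V) (use uv in auto)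
  finally show ?thesis .
qed

text \<open>
  With \<open>a\<close> fixed, \<open>mass2 B \<mu> a\<close> is the mass of a one-parameter measure \<open>\<nu>\<close>, and the
  one-parameter inequality applies with \<open>g = I\<^sub>1 f (a, \<cdot>)\<close>: its sums along ancestors are
  potentials.  The atom \<open>\<nu> v\<close> is not itself written as \<open>mass2 B \<mu> a v\<close>, as that would need
  \<open>v\<close> to be minimal in \<open>B\<close>.
\<close>

lemma sum_descendants_mass2_hardy1_le:
  assumes B: "finite B" and \<mu>: "\<And>u v. \<lbrakk>u \<in> B; v \<in> B\<rbrakk> \<Longrightarrow> 0 \<le> \<mu> u v"
    and V: "\<And>u v. \<lbrakk>u \<in> B; v \<in> B; 0 < \<mu> u v\<rbrakk> \<Longrightarrow> hardy12 (mass2 B \<mu>) u v \<le> d"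
  shows "(\<Sum>y | y \<in> T \<and> y \<le> b. mass2 B \<mu> a y * hardy1 (mass2 B \<mu>) a y) \<le> d * mass2 B \<mu> a b"
proof -
  define \<nu> where "\<nu> v = (\<Sum>u | u \<in> B \<and> u \<le> a. \<mu> u v)" for v
  have m: "mass2 B \<mu> a y = (\<Sum>v | v \<in> B \<and> v \<le> y. \<nu> v)" for y
    unfolding mass2_def \<nu>_def by (rule sum.swap)
  have \<nu>: "0 \<le> \<nu> v" if "v \<in> B" for v
    unfolding \<nu>_def by (rule sum_nonneg) (use \<mu> that in auto)
  have le: "(\<Sum>y\<in>anc v. hardy1 (mass2 B \<mu>) a y) \<le> d" if v: "v \<in> B" and pos: "0 < \<nu> v" for v
  proof -
    have "\<nu> v \<le> mass2 B \<mu> a v"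
      unfolding m by (rule member_le_sum) (use v \<nu> B in auto)
    with pos have "0 < mass2 B \<mu> a v" by simp
    from hardy12_mass2_le[OF \<mu> V this] show ?thesis by (simp add: hardy12_eq_sum_hardy1)
  qed
  have "0 \<le> hardy1 (mass2 B \<mu>) a y" for y
    by (rule hardy1_nonneg, rule mass2_nonneg, rule \<mu>)
  from sum_mass_times_le[OF B this \<nu> le] show ?thesis unfolding m .
qed

lemma sum_descendants_mass2_hardy2_le:
  assumes B: "finite B" and \<mu>: "\<And>u v. \<lbrakk>u \<in> B; v \<in> B\<rbrakk> \<Longrightarrow> 0 \<le> \<mu> u v"
    and V: "\<And>u v. \<lbrakk>u \<in> B; v \<in> B; 0 < \<mu> u v\<rbrakk> \<Longrightarrow> hardy12 (mass2 B \<mu>) u v \<le> d"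
  shows "(\<Sum>x | x \<in> T \<and> x \<le> a. mass2 B \<mu> x b * hardy2 (mass2 B \<mu>) x b) \<le> d * mass2 B \<mu> a b"
proof -
  have tr: "mass2 B (\<lambda>u v. \<mu> v u) = (\<lambda>x y. mass2 B \<mu> y x)"
    by (intro ext mass2_transpose)
  show ?thesis
    using sum_descendants_mass2_hardy1_le[of B "\<lambda>u v. \<mu> v u" d b a] B \<mu> V
    by (simp add: tr hardy1_transpose[of "mass2 B \<mu>"] hardy12_transpose[of "mass2 B \<mu>"])
qed

lemma sum_square_hardy1_hardy2_le:
  assumes B: "finite B" and \<mu>: "\<And>u v. \<lbrakk>u \<in> B; v \<in> B\<rbrakk> \<Longrightarrow> 0 \<le> \<mu> u v" and d: "0 \<le> d"
    and V: "\<And>u v. \<lbrakk>u \<in> B; v \<in> B; 0 < \<mu> u v\<rbrakk> \<Longrightarrow> hardy12 (mass2 B \<mu>) u v \<le> d"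
  shows "(\<Sum>x\<in>T. \<Sum>y\<in>T. (hardy1 (mass2 B \<mu>) x y * hardy2 (mass2 B \<mu>) x y)\<^sup>2)
    \<le> 4 * d\<^sup>2 * (\<Sum>x\<in>T. \<Sum>y\<in>T. (mass2 B \<mu> x y)\<^sup>2)"
proof -
  define f where "f = mass2 B \<mu>"
  have f: "0 \<le> f a b" for a b
    unfolding f_def by (rule mass2_nonneg, rule \<mu>)
  define G where "G a y = f a y * hardy1 f a y" for a y
  define H where "H x b = f x b * hardy2 f x b" for x b
  have G: "0 \<le> G a y" and H: "0 \<le> H a y" for a y
    by (simp_all add: G_def H_def f hardy1_nonneg hardy2_nonneg)
  have "(\<Sum>x\<in>T. \<Sum>y\<in>T. (hardy1 f x y * hardy2 f x y)\<^sup>2)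
      \<le> (\<Sum>x\<in>T. \<Sum>y\<in>T. (2 * (\<Sum>a\<in>anc x. G a y)) * (2 * (\<Sum>b\<in>anc y. H x b)))"
  proof (intro sum_mono)
    fix x y assume x: "x \<in> T" and y: "y \<in> T"
    have "(hardy1 f x y)\<^sup>2 \<le> 2 * (\<Sum>a\<in>anc x. G a y)"
      using square_sum_anc_le[OF x, of "\<lambda>a. f a y"] f by (simp add: hardy1_def G_def)
    moreover have "(hardy2 f x y)\<^sup>2 \<le> 2 * (\<Sum>b\<in>anc y. H x b)"
      using square_sum_anc_le[OF y, of "f x"] f by (simp add: hardy2_def H_def)
    ultimately show "(hardy1 f x y * hardy2 f x y)\<^sup>2
        \<le> (2 * (\<Sum>a\<in>anc x. G a y)) * (2 * (\<Sum>b\<in>anc y. H x b))"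
      unfolding power_mult_distrib by (intro mult_mono) (auto intro!: sum_nonneg G)
  qed
  also have "\<dots> = (\<Sum>x\<in>T. \<Sum>y\<in>T. 4 * ((\<Sum>a\<in>anc x. G a y) * (\<Sum>b\<in>anc y. H x b)))"
    by (intro sum.cong refl) simp
  also have "\<dots> = 4 * (\<Sum>x\<in>T. \<Sum>y\<in>T. \<Sum>a\<in>anc x. \<Sum>b\<in>anc y. G a y * H x b)"
    by (simp only: sum_product) (simp only: sum_distrib_left)
  (* after fixing (a, b), the sums over the descendants x of a and y of b decouple *)
  also have "(\<Sum>x\<in>T. \<Sum>y\<in>T. \<Sum>a\<in>anc x. \<Sum>b\<in>anc y. G a y * H x b)
      = (\<Sum>a\<in>T. \<Sum>b\<in>T. (\<Sum>y | y \<in> T \<and> y \<le> b. G a y) * (\<Sum>x | x \<in> T \<and> x \<le> a. H x b))"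
  proof -
    have "(\<Sum>x\<in>T. \<Sum>y\<in>T. \<Sum>a\<in>anc x. \<Sum>b\<in>anc y. G a y * H x b)
        = (\<Sum>x\<in>T. \<Sum>a\<in>anc x. \<Sum>y\<in>T. \<Sum>b\<in>anc y. G a y * H x b)"
      by (rule sum.cong[OF refl], rule sum.swap)
    also have "\<dots> = (\<Sum>a\<in>T. \<Sum>x | x \<in> T \<and> x \<le> a. \<Sum>y\<in>T. \<Sum>b\<in>anc y. G a y * H x b)"
      unfolding anc_def by (rule sum.swap_restrict[OF finite_T finite_T])
    also have "\<dots> = (\<Sum>a\<in>T. \<Sum>x | x \<in> T \<and> x \<le> a. \<Sum>b\<in>T. \<Sum>y | y \<in> T \<and> y \<le> b. G a y * H x b)"
      unfolding anc_def
      by (rule sum.cong[OF refl], rule sum.cong[OF refl], rule sum.swap_restrict[OF finite_T finite_T])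
    also have "\<dots> = (\<Sum>a\<in>T. \<Sum>b\<in>T. \<Sum>x | x \<in> T \<and> x \<le> a. \<Sum>y | y \<in> T \<and> y \<le> b. G a y * H x b)"
      by (rule sum.cong[OF refl], rule sum.swap)
    also have "\<dots> = (\<Sum>a\<in>T. \<Sum>b\<in>T. \<Sum>y | y \<in> T \<and> y \<le> b. \<Sum>x | x \<in> T \<and> x \<le> a. G a y * H x b)"
      by (rule sum.cong[OF refl], rule sum.cong[OF refl], rule sum.swap)
    finally show ?thesis by (simp only: sum_product)
  qed
  also have "\<dots> \<le> (\<Sum>a\<in>T. \<Sum>b\<in>T. (d * f a b) * (d * f a b))"
    unfolding G_def H_def f_def
    by (intro sum_mono mult_mono sum_descendants_mass2_hardy1_le[OF B \<mu> V]
        sum_descendants_mass2_hardy2_le[OF B \<mu> V])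
      (auto intro!: sum_nonneg mult_nonneg_nonneg d hardy2_nonneg simp: f[unfolded f_def])
  finally show ?thesis
    by (simp add: f_def power2_eq_square sum_distrib_left mult_ac)
qed

section \<open>The majorant on the square of a finite tree\<close>

text \<open>
  Where \<open>\<I> f \<ge> 4 d\<close>, half of \<open>(\<I> f)\<^sup>2\<close> absorbs the contribution \<open>2 d \<I> f\<close> of the nested pairs.
\<close>

lemma square_hardy12_mass2_le:
  assumes x: "x \<in> T" and y: "y \<in> T"
    and \<mu>: "\<And>u v. \<lbrakk>u \<in> B; v \<in> B\<rbrakk> \<Longrightarrow> 0 \<le> \<mu> u v"
    and V: "\<And>u v. \<lbrakk>u \<in> B; v \<in> B; 0 < \<mu> u v\<rbrakk> \<Longrightarrow> hardy12 (mass2 B \<mu>) u v \<le> d"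
    and d: "0 \<le> d" and large: "4 * d \<le> hardy12 (mass2 B \<mu>) x y"
  shows "(hardy12 (mass2 B \<mu>) x y)\<^sup>2
    \<le> 4 * hardy12 (\<lambda>a b. hardy1 (mass2 B \<mu>) a b * hardy2 (mass2 B \<mu>) a b) x y"
proof -
  let ?f = "mass2 B \<mu>"
  have f: "0 \<le> ?f a b" for a b by (rule mass2_nonneg, rule \<mu>)
  have "?f a b * hardy12 ?f a b \<le> d * ?f a b" for a b
  proof (cases "?f a b = 0")
    case False
    with f[of a b] have "0 < ?f a b" by simp
    with hardy12_mass2_le[OF \<mu> V this] show ?thesis by (simp add: mult.commute)
  qed simp
  then have "hardy12 (\<lambda>a b. ?f a b * hardy12 ?f a b) x y
      \<le> (\<Sum>a\<in>anc x. \<Sum>b\<in>anc y. d * ?f a b)"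
    unfolding hardy12_def[of "\<lambda>a b. ?f a b * hardy12 ?f a b"] by (intro sum_mono)
  also have "\<dots> = d * hardy12 ?f x y"
    by (simp add: hardy12_def sum_distrib_left)
  finally have nested: "hardy12 (\<lambda>a b. ?f a b * hardy12 ?f a b) x y \<le> d * hardy12 ?f x y" .
  have "4 * d * hardy12 ?f x y \<le> hardy12 ?f x y * hardy12 ?f x y"
    by (rule mult_right_mono[OF large]) (use large d in linarith)
  with nested square_hardy12_le[OF x y, of ?f, OF f] show ?thesis
    by (simp add: power2_eq_square)
qed

end

section \<open>The dyadic tree\<close>

lemma dyadic_interval_bounds_nonempty: "real j / 2 ^ k < (real j + 1) / 2 ^ k"
  by (simp add: divide_strict_right_mono)

lemma dyadic_tree_nonempty: "a \<in> dyadic_tree N \<Longrightarrow> a \<noteq> {}"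
  by (auto simp: dyadic_tree_def dyadic_interval_def divide_right_mono)

text \<open>
  Scaling by \<open>2 ^ k'\<close> turns the finer interval into \<open>{j' .. j' + 1}\<close> and the coarser one into an
  interval with integer end points \<open>j m\<close> and \<open>(j + 1) m\<close>, where \<open>m = 2 ^ (k' - k)\<close>; if they
  overlap in more than a point, integrality forces inclusion.
\<close>

lemma dyadic_interval_nested:
  assumes k: "k \<le> k'" and p: "p < q"
    and sub: "{p..q} \<subseteq> dyadic_interval k j" "{p..q} \<subseteq> dyadic_interval k' j'"
  shows "dyadic_interval k' j' \<subseteq> dyadic_interval k j"
proof -
  define m :: nat where "m = 2 ^ (k' - k)"
  have pow: "(2::real) ^ k' = 2 ^ k * real m"
    using k by (simp add: m_def flip: power_add)
  have m: "0 < real m" by (simp add: m_def)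
  have scale: "real i / 2 ^ k = real (i * m) / 2 ^ k'" for i
    using m by (simp add: pow field_simps)
  have bounds: "real j / 2 ^ k \<le> p" "q \<le> real (Suc j) / 2 ^ k"
    "real j' / 2 ^ k' \<le> p" "q \<le> real (Suc j') / 2 ^ k'"
    using sub p by (auto simp: dyadic_interval_def add.commute)
  then have "real (j * m) / 2 ^ k' < real (Suc j') / 2 ^ k'"
    "real j' / 2 ^ k' < real (Suc j * m) / 2 ^ k'"
    using p unfolding scale[of j] scale[of "Suc j"] by linarith+
  then have "j * m < Suc j'" "j' < Suc j * m"
    by (simp_all only: divide_less_cancel of_nat_less_iff) auto
  then have "j * m \<le> j'" "Suc j' \<le> Suc j * m" by simp_all
  then have "real j / 2 ^ k \<le> real j' / 2 ^ k'"
    "real (Suc j') / 2 ^ k' \<le> real (Suc j) / 2 ^ k"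
    unfolding scale[of j] scale[of "Suc j"]
    by (simp_all only: divide_right_mono of_nat_le_iff zero_le_power zero_le_numeral)
  then show ?thesis by (simp add: dyadic_interval_def add.commute)
qed

interpretation dyadic: finite_tree "dyadic_tree N" for N
proof
  fix x a b assume "x \<in> dyadic_tree N" "a \<in> dyadic_tree N" "b \<in> dyadic_tree N"
    and le: "x \<le> a" "x \<le> b"
  then obtain i j k l m n where
    x: "x = dyadic_interval k i" and a: "a = dyadic_interval l j" and b: "b = dyadic_interval m n"
    by (auto simp: dyadic_tree_def)
  note sub = le[unfolded a b x dyadic_interval_def[of k i], folded a b]
  note p = dyadic_interval_bounds_nonempty[of i k]
  show "a \<le> b \<or> b \<le> a"
  proof (cases "l \<le> m")
    case True
    then show ?thesis using dyadic_interval_nested[OF True p] sub unfolding a b by blast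
  next
    case False
    then have "m \<le> l" by simp
    then show ?thesis using dyadic_interval_nested[OF _ p] sub unfolding a b by blast
  qed
qed (rule finite_dyadic_tree)

lemma dyadic_tree_boundary_subset: "dyadic_tree_boundary N \<subseteq> dyadic_tree N"
  by (auto simp: dyadic_tree_boundary_def dyadic_tree_def)

lemma node_le_iff:
  assumes "a \<in> dyadic_tree N" "b \<in> dyadic_tree N"
  shows "node_le (a, b) (c, d) \<longleftrightarrow> a \<le> c \<and> b \<le> d"
  using dyadic_tree_nonempty[OF assms(1)] dyadic_tree_nonempty[OF assms(2)]
  by (auto simp: node_le_def rect_def times_subset_iff)

lemma hardy_eq_hardy12:
  assumes "x \<in> dyadic_tree N" "y \<in> dyadic_tree N"
  shows "hardy N \<phi> (x, y) = dyadic.hardy12 N (\<lambda>a b. \<phi> (a, b)) x y"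
proof -
  have "{\<beta>. \<beta> \<in> bitree N \<and> node_le (x, y) \<beta>} = dyadic.anc N x \<times> dyadic.anc N y"
    by (auto simp: bitree_def node_le_iff[OF assms] dyadic.anc_def)
  then show ?thesis
    by (simp add: hardy_def dyadic.hardy12_def sum.cartesian_product)
qed

lemma mass_eq_mass2:
  "mass N \<mu> (a, b) = dyadic.mass2 (dyadic_tree_boundary N) (\<lambda>u v. \<mu> (u, v)) a b"
proof -
  let ?B = "dyadic_tree_boundary N"
  have "{\<omega>. \<omega> \<in> bitree_boundary N \<and> node_le \<omega> (a, b)} = {u \<in> ?B. u \<le> a} \<times> {v \<in> ?B. v \<le> b}"
    by (auto simp: bitree_boundary_def
        node_le_iff[OF dyadic_tree_boundary_subset[THEN subsetD]
          dyadic_tree_boundary_subset[THEN subsetD]])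
  then show ?thesis
    by (simp add: mass_def dyadic.mass2_def sum.cartesian_product)
qed

theorem theorem1p11:
  shows "\<exists>lam0 C :: real. 1 \<le> lam0 \<and> 0 < C \<and>
    (\<forall>(N :: nat) (lam :: real) (\<mu> :: node \<Rightarrow> real) (F :: node set).
       1 \<le> N \<longrightarrow> lam0 \<le> lam \<longrightarrow>
       boundary_measure N \<mu> \<longrightarrow>
       (\<forall>\<omega>\<in>measure_supp N \<mu>. potential N \<mu> \<omega> \<le> 1) \<longrightarrow>
       F \<subseteq> bitree_boundary N \<longrightarrow>
       (\<forall>\<omega>\<in>F. lam \<le> potential N \<mu> \<omega>) \<longrightarrow>
       (\<exists>\<phi> :: node \<Rightarrow> real.
          (\<forall>\<alpha>\<in>bitree N. 0 \<le> \<phi> \<alpha>) \<and>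
          (\<forall>\<omega>\<in>F. lam \<le> hardy N \<phi> \<omega>) \<and>
          l2_norm_sq N \<phi> \<le> C / lam * energy N \<mu>))"
proof (rule exI[of _ 4], rule exI[of _ 64], intro conjI allI impI)
  fix N :: nat and lam :: real and \<mu> :: "node \<Rightarrow> real" and F :: "node set"
  assume lam: "4 \<le> lam" and meas: "boundary_measure N \<mu>"
    and supp: "\<forall>\<omega>\<in>measure_supp N \<mu>. potential N \<mu> \<omega> \<le> 1"
    and F: "F \<subseteq> bitree_boundary N" and large: "\<forall>\<omega>\<in>F. lam \<le> potential N \<mu> \<omega>"
  let ?T = "dyadic_tree N" and ?B = "dyadic_tree_boundary N"
  define \<mu>' where "\<mu>' = (\<lambda>u v. \<mu> (u, v))"
  define f where "f = dyadic.mass2 ?B \<mu>'"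
  note BT = subsetD[OF dyadic_tree_boundary_subset[of N]]
  have B: "finite ?B"
    using dyadic_tree_boundary_subset finite_dyadic_tree by (rule finite_subset)
  have \<mu>': "0 \<le> \<mu>' u v" if "u \<in> ?B" "v \<in> ?B" for u v
    using meas that by (simp add: boundary_measure_def bitree_boundary_def \<mu>'_def)
  have mass: "mass N \<mu> (a, b) = f a b" for a b
    by (simp add: f_def \<mu>'_def mass_eq_mass2)
  have potential: "potential N \<mu> (x, y) = dyadic.hardy12 N f x y" if "x \<in> ?T" "y \<in> ?T" for x y
    using hardy_eq_hardy12[OF that, of "mass N \<mu>"] by (simp add: potential_def hardy_def mass)
  have V: "dyadic.hardy12 N (dyadic.mass2 ?B \<mu>') u v \<le> 1"
    if uv: "u \<in> ?B" "v \<in> ?B" "0 < \<mu>' u v" for u v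
  proof -
    have "(u, v) \<in> measure_supp N \<mu>"
      using uv by (simp add: measure_supp_def bitree_boundary_def \<mu>'_def)
    with supp have "potential N \<mu> (u, v) \<le> 1" by blast
    then show ?thesis using potential[OF BT BT, OF uv(1,2)] by (simp add: f_def)
  qed
  have f: "0 \<le> f a b" for a b
    unfolding f_def by (rule dyadic.mass2_nonneg, rule \<mu>')
  define h where "h = (\<lambda>a b. dyadic.hardy1 N f a b * dyadic.hardy2 N f a b)"
  have h: "0 \<le> h a b" for a b
    unfolding h_def by (intro mult_nonneg_nonneg dyadic.hardy1_nonneg dyadic.hardy2_nonneg f)
  define \<phi> :: "node \<Rightarrow> real" where "\<phi> = (\<lambda>(a, b). 4 / lam * h a b)"
  show "\<exists>\<phi> :: node \<Rightarrow> real. (\<forall>\<alpha>\<in>bitree N. 0 \<le> \<phi> \<alpha>) \<and>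
      (\<forall>\<omega>\<in>F. lam \<le> hardy N \<phi> \<omega>) \<and> l2_norm_sq N \<phi> \<le> 64 / lam * energy N \<mu>"
  proof (intro exI[of _ \<phi>] conjI ballI)
    show "0 \<le> \<phi> \<alpha>" for \<alpha>
      using lam h by (simp add: \<phi>_def case_prod_beta)
  next
    fix \<omega> assume \<omega>: "\<omega> \<in> F"
    obtain x y where xy: "\<omega> = (x, y)" by (cases \<omega>)
    have x: "x \<in> ?T" and y: "y \<in> ?T"
      using \<omega> F BT by (auto simp: xy bitree_boundary_def)
    have V\<omega>: "lam \<le> dyadic.hardy12 N f x y"
      using large \<omega> potential[OF x y] by (auto simp: xy)
    have "lam\<^sup>2 \<le> (dyadic.hardy12 N f x y)\<^sup>2"
      using V\<omega> lam by (intro power_mono) auto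
    also have "\<dots> \<le> 4 * dyadic.hardy12 N h x y"
      unfolding h_def f_def
      by (rule dyadic.square_hardy12_mass2_le[OF x y \<mu>' V])
        (use V\<omega> lam in \<open>simp_all add: f_def\<close>)
    finally have "lam * lam \<le> 4 * dyadic.hardy12 N h x y" by (simp add: power2_eq_square)
    then have "lam \<le> 4 / lam * dyadic.hardy12 N h x y"
      using lam by (simp add: field_simps)
    also have "\<dots> = hardy N \<phi> \<omega>"
      by (simp add: xy hardy_eq_hardy12[OF x y] \<phi>_def dyadic.hardy12_def sum_distrib_left)
    finally show "lam \<le> hardy N \<phi> \<omega>" .
  next
    have energy: "energy N \<mu> = (\<Sum>x\<in>?T. \<Sum>y\<in>?T. (f x y)\<^sup>2)"
      by (simp add: energy_def bitree_def mass sum.cartesian_product')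
    then have E: "0 \<le> energy N \<mu>" by (simp add: sum_nonneg)
    have "l2_norm_sq N \<phi> = (4 / lam)\<^sup>2 * (\<Sum>x\<in>?T. \<Sum>y\<in>?T. (h x y)\<^sup>2)"
      by (simp only: l2_norm_sq_def bitree_def sum.cartesian_product' \<phi>_def case_prod_conv
          power_mult_distrib sum_distrib_left)
    also have "(\<Sum>x\<in>?T. \<Sum>y\<in>?T. (h x y)\<^sup>2) \<le> 4 * energy N \<mu>"
      using dyadic.sum_square_hardy1_hardy2_le[OF B \<mu>' _ V]
      by (simp add: h_def f_def energy)
    then have "(4 / lam)\<^sup>2 * (\<Sum>x\<in>?T. \<Sum>y\<in>?T. (h x y)\<^sup>2) \<le> (4 / lam)\<^sup>2 * (4 * energy N \<mu>)"
      by (rule mult_left_mono) simp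
    also have "\<dots> = (64 / lam * energy N \<mu>) / lam"
      by (simp add: power2_eq_square)
    also have "\<dots> \<le> (64 / lam * energy N \<mu>) / 1"
      using lam E by (intro divide_left_mono mult_nonneg_nonneg) auto
    finally show "l2_norm_sq N \<phi> \<le> 64 / lam * energy N \<mu>" by simp
  qed
qed simp_all

end
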